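(* For every $n\ge1$, \[\#\widehat{P}_B(\emptyset,n)=\frac{3^n+1}{2}.\]
   Context: $B_n$ is the set of signed permutations $\pi=\pi_1\cdots\pi_n$: words with each $\pi_i\in\{-n,\dots,-1,1,\dots,n\}$ and $\{|\pi_1|,\dots,|\pi_n|\}=\{1,\dots,n\}$. Set $\pi_0=0$. An index $i\in\{1,\dots,n-1\}$ is a peak of $\pi$ if $\pi_{i-1}<\pi_i>\pi_{i+1}$. $\widehat{P}_B(S,n)$ is the set of $\pi\in B_n$ whose peak set (in this sense) equals $S$; thus $\widehat{P}_B(\emptyset,n)$ is the set of signed permutations with no peaks when $\pi_0=0$ is prepended. *)

theory Defs
  imports Complex_Main
begin

definition signed_perms :: "nat \<Rightarrow> int list set" where
  "signed_perms n = {w. length w = n \<and>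
     set w \<subseteq> {- int n..-1} \<union> {1..int n} \<and> abs ` set w = {1..int n}}"

(* Prepending 0 to the word makes list position i hold the i-th letter, with letter 0 equal to 0. *)
definition peak_set_B :: "int list \<Rightarrow> nat set" where
  "peak_set_B w = {i \<in> {1..length w - 1}.
     (0 # w) ! (i - 1) < (0 # w) ! i \<and> (0 # w) ! i > (0 # w) ! (i + 1)}"

definition P_hat_B :: "nat set \<Rightarrow> nat \<Rightarrow> int list set" where
  "P_hat_B S n = {w \<in> signed_perms n. peak_set_B w = S}"

end

theory Submission
  imports Defs
begin

text \<open>
  A signed permutation has no peak iff, after prepending 0, it descends strictly through negative
  letters and then ascends strictly. Such a word is determined by the set \<open>A\<close> of descending
  letters and the set \<open>B\<close> of negative ascending letters, where \<open>A\<close> and \<open>B\<close> are disjoint and every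
  element of \<open>B\<close> exceeds \<open>Min (insert 0 A)\<close>. Among the \<open>3 ^ n\<close> disjoint pairs of subsets of
  \<open>{-n..-1}\<close>, swapping \<open>A\<close> and \<open>B\<close> exchanges the admissible and the inadmissible ones,
  except that the admissible pair \<open>({}, {})\<close> is fixed.
\<close>

section \<open>Words without peaks: a strict descent followed by a strict ascent\<close>

fun peak_free :: "'a::linorder list \<Rightarrow> bool" where
  "peak_free (a # b # c # w) \<longleftrightarrow> \<not> (a < b \<and> c < b) \<and> peak_free (b # c # w)"
| "peak_free _ \<longleftrightarrow> True"

lemma peak_free_iff_nth:
  "peak_free w \<longleftrightarrow> (\<forall>i. i + 2 < length w \<longrightarrow> \<not> (w ! i < w ! (i + 1) \<and> w ! (i + 2) < w ! (i + 1)))"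
proof (induction w rule: peak_free.induct)
  case (1 a b c w)
  have "(\<forall>i. Q i) \<longleftrightarrow> Q 0 \<and> (\<forall>i. Q (Suc i))" for Q :: "nat \<Rightarrow> bool"
    by (metis not0_implies_Suc)
  \<comment> \<open>Index 0 is the triple at the head and the successors are the triples of the
    tail; the dummy \<open>_ i\<close> leaves the peak condition to unification.\<close>
  note split = this[of "\<lambda>i. i + 2 < length (a # b # c # w) \<longrightarrow> _ i"]
  show ?case
    unfolding peak_free.simps 1 split by simp
qed auto

lemma peak_set_B_empty_iff: "peak_set_B w = {} \<longleftrightarrow> peak_free (0 # w)"
proof -
  \<comment> \<open>Peaks are indexed by the middle of a triple, \<open>peak_free_iff_nth\<close> by
    its first entry; hence the shift by \<open>Suc\<close>.\<close>
  have "{1..length w - 1} = Suc ` {..<length w - 1}"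
    by (simp add: image_Suc_lessThan)
  then have "peak_set_B w = {} \<longleftrightarrow> (\<forall>i\<in>Suc ` {..<length w - 1}.
      \<not> ((0 # w) ! (i - 1) < (0 # w) ! i \<and> (0 # w) ! (i + 1) < (0 # w) ! i))"
    unfolding peak_set_B_def by blast
  also have "\<dots> \<longleftrightarrow> peak_free (0 # w)"
    unfolding peak_free_iff_nth by (auto simp: less_diff_conv)
  finally show ?thesis .
qed

text \<open>After an ascent, the first descent would create a peak; distinctness excludes equal
  neighbours.\<close>

lemma peak_free_ascending:
  assumes "peak_free (a # b # w)" "a < b" "distinct (a # b # w)"
  shows "sorted_wrt (<) (a # b # w)"
  using assms
proof (induction w arbitrary: a b)
  case (Cons c w)
  then have "b < c" by auto
  with Cons have "sorted_wrt (<) (b # c # w)" by auto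
  with \<open>a < b\<close> show ?case by auto
qed auto

text \<open>The next letter either rises, and then everything after it rises by
  \<open>peak_free_ascending\<close>, or it prolongs the descent. Attaching the valley
  \<open>last (a # D)\<close> to \<open>I\<close> also covers an empty \<open>D\<close>, where the
  valley is \<open>a\<close>.\<close>

lemma peak_free_decompose:
  assumes "peak_free (a # w)" "distinct (a # w)"
  shows "\<exists>D I. w = D @ I \<and> sorted_wrt (>) (a # D) \<and> sorted_wrt (<) (last (a # D) # I)"
  using assms
proof (induction w arbitrary: a)
  case (Cons b w)
  show ?case
  proof (cases "a < b")
    case True
    with Cons.prems peak_free_ascending have "sorted_wrt (<) (a # b # w)" by blast
    then show ?thesis by (intro exI[of _ "[]"] exI[of _ "b # w"]) auto
  next
    case False
    with Cons.prems have "b < a" by auto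
    moreover have "peak_free (b # w)" using Cons.prems by (cases w) auto
    then obtain D I where "w = D @ I" "sorted_wrt (>) (b # D)" "sorted_wrt (<) (last (b # D) # I)"
      using Cons.IH[of b] Cons.prems by auto
    ultimately show ?thesis by (intro exI[of _ "b # D"] exI[of _ I]) auto
  qed
qed auto

lemma peak_free_if_sorted: "sorted_wrt (<) w \<Longrightarrow> peak_free w"
  by (induction w rule: peak_free.induct) auto

lemma peak_free_append:
  assumes "sorted_wrt (>) (a # D)" "sorted_wrt (<) (last (a # D) # I)"
  shows "peak_free (a # D @ I)"
  using assms
proof (induction D arbitrary: a)
  case Nil
  then show ?case using peak_free_if_sorted[of "a # I"] by simp
next
  case (Cons b D)
  then have "peak_free (b # D @ I)" "b < a" by auto
  then show ?case by (cases "D @ I") auto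
qed

text \<open>The cut is forced: the letter after the valley exceeds it, whereas each letter of the
  descent is below its left neighbour.\<close>

lemma descending_ascending_unique:
  fixes a :: "'a::linorder"
  assumes "D @ I = D' @ I'"
    and "sorted_wrt (>) (a # D)" "sorted_wrt (<) (last (a # D) # I)"
    and "sorted_wrt (>) (a # D')" "sorted_wrt (<) (last (a # D') # I')"
  shows "D = D'"
  using assms
proof (induction D arbitrary: a D')
  case Nil
  then show ?case by (cases D') auto
next
  case (Cons b D)
  then show ?case by (cases D') (auto split: if_splits)
qed

text \<open>The last entry of a strictly descending list is its minimum. This turns the condition on
  the valley into the existential form used in \<open>dominated_pairs\<close>.\<close>

lemma last_less_iff_if_descending:
  fixes a :: "'a::linorder"
  assumes "sorted_wrt (>) (a # D)"
  shows "last (a # D) < y \<longleftrightarrow> (\<exists>x\<in>set (a # D). x < y)"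
  using assms
proof (induction D arbitrary: a)
  case (Cons b D)
  then show ?case by (auto intro: less_trans)
qed auto

section \<open>Counting pairs of disjoint subsets\<close>

lemma card_disjoint_pairs:
  assumes "finite S"
  shows "card {(A, B). A \<subseteq> S \<and> B \<subseteq> S \<and> A \<inter> B = {}} = 3 ^ card S"
proof -
  have "{(A, B). A \<subseteq> S \<and> B \<subseteq> S \<and> A \<inter> B = {}} = (SIGMA A:Pow S. Pow (S - A))"
    by auto
  also have "card \<dots> = (\<Sum>A\<in>Pow S. 2 ^ card (S - A))"
    using assms by (subst card_SigmaI) (auto simp: card_Pow)
  \<comment> \<open>Each element of \<open>A\<close> has weight 1, each other element weight 2 for
    being in \<open>B\<close> or not; \<open>prod_add\<close> read backwards contracts the sum over
    subsets to a product.\<close>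
  also have "\<dots> = (\<Sum>A\<in>Pow S. (\<Prod>x\<in>A. 1) * (\<Prod>x\<in>S - A. 2))"
    by simp
  also have "\<dots> = (\<Prod>x\<in>S. 1 + 2)"
    using assms by (subst prod_add) simp_all
  finally show ?thesis by (simp add: numeral_3_eq_3)
qed

text \<open>
  For negative letters, the condition \<open>Min (insert 0 A) < b\<close> becomes \<open>\<exists>a\<in>A. a < b\<close>,
  which forces \<open>B = {}\<close> when \<open>A = {}\<close>.
\<close>

definition dominated_pairs :: "'a::linorder set \<Rightarrow> ('a set \<times> 'a set) set" where
  "dominated_pairs S =
    {(A, B). A \<subseteq> S \<and> B \<subseteq> S \<and> A \<inter> B = {} \<and> (\<forall>b\<in>B. \<exists>a\<in>A. a < b)}"

text \<open>A disjoint pair other than \<open>({}, {})\<close> is dominated exactly if the minimum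
  of \<open>A \<union> B\<close> lies in \<open>A\<close>. So the dominated pairs and their images
  under swapping cover all disjoint pairs and share only \<open>({}, {})\<close>.\<close>

lemma card_dominated_pairs:
  assumes "finite S"
  shows "2 * card (dominated_pairs S) = 3 ^ card S + 1"
proof -
  let ?R = "{(A, B). A \<subseteq> S \<and> B \<subseteq> S \<and> A \<inter> B = {}}" and ?Q = "dominated_pairs S"
  have Min_cases: "Min (A \<union> B) \<in> A \<union> B \<and> (\<forall>x\<in>A \<union> B. Min (A \<union> B) \<le> x)"
    if "A \<subseteq> S" "B \<subseteq> S" "A \<union> B \<noteq> {}" for A B
    using that assms Min_in[of "A \<union> B"] finite_subset[of _ S] by auto
  have "?R \<subseteq> Pow S \<times> Pow S" by auto
  then have "finite ?R" by (rule finite_subset) (simp add: assms)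
  then have finQ: "finite ?Q"
    by (rule rev_finite_subset) (auto simp: dominated_pairs_def)
  have R_cases: "(A, B) \<in> ?Q \<or> (B, A) \<in> ?Q" if "(A, B) \<in> ?R" for A B
  proof (cases "A \<union> B = {}")
    case False
    with that Min_cases[of A B] consider
        m where "m \<in> A" "\<forall>x\<in>A \<union> B. m \<le> x" | m where "m \<in> B" "\<forall>x\<in>A \<union> B. m \<le> x"
      by auto
    then show ?thesis
    proof cases
      case 1
      then have "\<forall>b\<in>B. m < b" using that by (auto simp: order.strict_iff_order)
      then show ?thesis using that 1 by (auto simp: dominated_pairs_def)
    next
      case 2
      then have "\<forall>a\<in>A. m < a" using that by (auto simp: order.strict_iff_order)
      then show ?thesis using that 2 by (auto simp: dominated_pairs_def)
    qed
  qed (auto simp: dominated_pairs_def)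
  have "?R \<subseteq> ?Q \<union> prod.swap ` ?Q"
    by (rule subrelI, drule R_cases) (simp only: Un_iff pair_in_swap_image)
  moreover have "?Q \<subseteq> ?R" "prod.swap ` ?Q \<subseteq> ?R"
    by (auto simp: dominated_pairs_def)
  ultimately have Un: "?R = ?Q \<union> prod.swap ` ?Q"
    by (intro equalityI Un_least)
  have Q_antisym: "A = {} \<and> B = {}" if "(A, B) \<in> ?Q" "(B, A) \<in> ?Q" for A B
  proof (rule ccontr)
    assume "\<not> ?thesis"
    with that have "Min (A \<union> B) \<in> A \<union> B" and min: "\<forall>x\<in>A \<union> B. Min (A \<union> B) \<le> x"
      using Min_cases[of A B] by (auto simp: dominated_pairs_def)
    \<comment> \<open>Domination in both directions gives the minimum a strictly smaller element in
      the other set.\<close>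
    with that obtain x where "x \<in> A \<union> B" "x < Min (A \<union> B)"
      unfolding dominated_pairs_def by blast
    with min show False by (meson not_le)
  qed
  have "?Q \<inter> prod.swap ` ?Q \<subseteq> {({}, {})}"
    by (rule subrelI) (use Q_antisym in \<open>simp only: Int_iff pair_in_swap_image, blast\<close>)
  moreover have "({}, {}) \<in> ?Q" "({}, {}) \<in> prod.swap ` ?Q"
    by (simp_all add: dominated_pairs_def)
  ultimately have Int: "?Q \<inter> prod.swap ` ?Q = {({}, {})}"
    by blast
  have "2 * card ?Q = card ?Q + card (prod.swap ` ?Q)"
    by (simp add: card_image)
  \<comment> \<open>Inclusion-exclusion; the extra 1 is the common pair
    \<open>({}, {})\<close>.\<close>
  also have "\<dots> = card ?R + 1"
    using card_Un_Int[OF finQ, of "prod.swap ` ?Q"] finQ by (simp add: Un Int)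
  finally show ?thesis using card_disjoint_pairs[OF assms] by simp
qed

section \<open>The bijection with peak-free signed permutations\<close>

definition ascent_letters :: "nat \<Rightarrow> int set \<Rightarrow> int set \<Rightarrow> int set" where
  "ascent_letters n A B = B \<union> ({1..int n} - uminus ` (A \<union> B))"

definition valley_word :: "nat \<Rightarrow> int set \<times> int set \<Rightarrow> int list" where
  "valley_word n = (\<lambda>(A, B).
    rev (sorted_list_of_set A) @ sorted_list_of_set (ascent_letters n A B))"

lemma sorted_valley_word:
  assumes "(A, B) \<in> dominated_pairs {- int n..-1}"
  defines "D \<equiv> rev (sorted_list_of_set A)"
    and "I \<equiv> sorted_list_of_set (ascent_letters n A B)"
  shows "sorted_wrt (>) (0 # D)" "sorted_wrt (<) (last (0 # D) # I)"
    "set D = A" "set I = ascent_letters n A B"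
proof -
  have fin: "finite A" "finite B" and sub: "A \<subseteq> {- int n..-1}" "B \<subseteq> {- int n..-1}"
    and dom: "\<forall>b\<in>B. \<exists>a\<in>A. a < b"
    using assms(1) by (auto simp: dominated_pairs_def intro: finite_subset)
  show setD: "set D = A" and setI: "set I = ascent_letters n A B"
    using fin by (auto simp: D_def I_def ascent_letters_def)
  show desc: "sorted_wrt (>) (0 # D)"
    using sub setD by (auto simp: D_def sorted_wrt_rev)
  \<comment> \<open>The witness is an element of \<open>A\<close> for letters of \<open>B\<close>,
    and the prepended 0 for positive letters.\<close>
  have "\<forall>y\<in>set I. \<exists>x\<in>set (0 # D). x < y"
    using dom by (auto simp: setI setD ascent_letters_def)
  then show "sorted_wrt (<) (last (0 # D) # I)"
    using last_less_iff_if_descending[OF desc] by (auto simp: I_def)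
qed

lemma valley_word_in_P_hat_B:
  assumes "(A, B) \<in> dominated_pairs {- int n..-1}"
  shows "valley_word n (A, B) \<in> P_hat_B {} n"
proof -
  let ?C = "ascent_letters n A B"
  note sorted = sorted_valley_word[OF assms]
  have sub: "A \<subseteq> {- int n..-1}" "B \<subseteq> {- int n..-1}" and disj: "A \<inter> B = {}"
    using assms by (auto simp: dominated_pairs_def)
  then have fin: "finite A" "finite B" by (auto intro: finite_subset)
  then have finC: "finite ?C" by (simp add: ascent_letters_def)
  have set: "set (valley_word n (A, B)) = A \<union> ?C"
    using fin finC by (simp add: valley_word_def)
  have abs: "abs ` (A \<union> ?C) = {1..int n}"
  proof
    show "abs ` (A \<union> ?C) \<subseteq> {1..int n}"
      using sub by (fastforce simp: ascent_letters_def)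
    show "{1..int n} \<subseteq> abs ` (A \<union> ?C)"
    proof
      fix x assume "x \<in> {1..int n}"
      then have "x = \<bar>x\<bar>" "x = \<bar>- x\<bar>" "x \<in> ?C \<or> - x \<in> A \<union> B"
        by (auto simp: ascent_letters_def image_iff)
      then show "x \<in> abs ` (A \<union> ?C)"
        by (metis UnCI UnE ascent_letters_def image_eqI)
    qed
  qed
  \<comment> \<open>No letter occurs with both signs, so counting letters amounts to counting
    absolute values.\<close>
  have inj: "inj_on abs (A \<union> ?C)"
    using sub by (force simp: inj_on_def ascent_letters_def abs_if)
  have "A \<inter> ?C = {}"
    using sub disj by (auto simp: ascent_letters_def)
  then have "length (valley_word n (A, B)) = card (A \<union> ?C)"
    using fin finC by (simp add: valley_word_def card_Un_disjoint)
  also have "\<dots> = n"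
    using card_image[OF inj] abs by simp
  finally have "valley_word n (A, B) \<in> signed_perms n"
    using sub abs by (auto simp: signed_perms_def set ascent_letters_def)
  moreover have "peak_free (0 # valley_word n (A, B))"
    using peak_free_append[OF sorted(1,2)] by (simp add: valley_word_def)
  ultimately show ?thesis
    by (simp add: P_hat_B_def peak_set_B_empty_iff)
qed

text \<open>Uniqueness of the cut recovers \<open>A\<close> and the ascending letters from the word;
  \<open>B\<close> is then the negative part of the latter.\<close>

lemma inj_on_valley_word: "inj_on (valley_word n) (dominated_pairs {- int n..-1})"
proof (rule inj_onI, clarify)
  fix A B A' B'
  assume in_Q: "(A, B) \<in> dominated_pairs {- int n..-1}" "(A', B') \<in> dominated_pairs {- int n..-1}"
    and eq: "valley_word n (A, B) = valley_word n (A', B')"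
  note s = sorted_valley_word[OF in_Q(1)] and s' = sorted_valley_word[OF in_Q(2)]
  have D: "rev (sorted_list_of_set A) = rev (sorted_list_of_set A')"
    by (rule descending_ascending_unique[OF _ s(1,2) s'(1,2)])
      (use eq in \<open>simp add: valley_word_def\<close>)
  then have "A = A'" using s(3) s'(3) by simp
  moreover have "sorted_list_of_set (ascent_letters n A B) = sorted_list_of_set (ascent_letters n A' B')"
    using D eq by (simp add: valley_word_def)
  then have "ascent_letters n A B = ascent_letters n A' B'"
    using s(4) s'(4) by metis
  moreover have "B = ascent_letters n A B \<inter> {..-1}" "B' = ascent_letters n A' B' \<inter> {..-1}"
    using in_Q by (auto simp: ascent_letters_def dominated_pairs_def)
  ultimately show "A = A' \<and> B = B'" by metis
qed

text \<open>Surjectivity: cut the word at its valley and read off \<open>A\<close> from the descent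
  and \<open>B\<close> from the negative letters of the ascent.\<close>

lemma P_hat_B_subset_valley_word:
  "P_hat_B {} n \<subseteq> valley_word n ` dominated_pairs {- int n..-1}"
proof
  fix w assume w: "w \<in> P_hat_B {} n"
  then have len: "length w = n" and sub: "set w \<subseteq> {- int n..-1} \<union> {1..int n}"
    and abs: "abs ` set w = {1..int n}" and pf: "peak_free (0 # w)"
    by (auto simp: P_hat_B_def signed_perms_def peak_set_B_empty_iff)
  \<comment> \<open>\<open>n\<close> different absolute values need \<open>n\<close> different
    letters, so in a word of length \<open>n\<close> no letter repeats and none occurs with both
    signs.\<close>
  have "n \<le> card (set w)"
    using card_image_le[of "set w" abs] abs by simp
  then have card: "card (set w) = n" using len card_length[of w] by simp
  then have dist: "distinct w" using len by (simp add: card_distinct)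
  have inj: "inj_on abs (set w)"
    using abs card by (intro eq_card_imp_inj_on) auto
  have "distinct (0 # w)" using dist sub by auto
  from peak_free_decompose[OF pf this] obtain D I where w_eq: "w = D @ I"
    and desc: "sorted_wrt (>) (0 # D)" and asc: "sorted_wrt (<) (last (0 # D) # I)"
    by blast
  define A B where "A = set D" and "B = set I \<inter> {..-1}"
  have "\<exists>a\<in>A. a < b" if "b \<in> B" for b
  proof -
    have "last (0 # D) < b" using asc that by (auto simp: B_def)
    \<comment> \<open>The smaller entry found in \<open>0 # D\<close> is not the prepended 0,
      because \<open>b\<close> is negative.\<close>
    then show ?thesis
      using last_less_iff_if_descending[OF desc] that by (auto simp: A_def B_def)
  qed
  then have in_Q: "(A, B) \<in> dominated_pairs {- int n..-1}"
    using sub desc dist by (force simp: w_eq A_def B_def dominated_pairs_def)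
  have "set I = ascent_letters n A B"
  proof (intro set_eqI iffI)
    fix x assume x: "x \<in> set I"
    show "x \<in> ascent_letters n A B"
    proof (cases "x < 0")
      case True
      with x show ?thesis by (auto simp: ascent_letters_def B_def)
    next
      case False
      then have "x \<in> {1..int n}" using x sub by (auto simp: w_eq)
      moreover have "- x \<notin> A \<union> B"
      proof
        assume "- x \<in> A \<union> B"
        then have "- x \<in> set w" by (auto simp: w_eq A_def B_def)
        with x have "- x = x" by - (rule inj_onD[OF inj], auto simp: w_eq)
        with \<open>x \<in> {1..int n}\<close> show False by simp
      qed
      ultimately show ?thesis by (auto simp: ascent_letters_def)
    qed
  next
    fix x assume x: "x \<in> ascent_letters n A B"
    show "x \<in> set I"
    proof (cases "x \<in> B")
      case False
      with x have "x \<in> {1..int n}" and neg: "- x \<notin> A \<union> B"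
        by (force simp: ascent_letters_def)+
      with abs have "x \<in> abs ` set w" by simp
      with \<open>x \<in> {1..int n}\<close> have "x \<in> set w \<or> - x \<in> set w"
        by (auto simp: abs_if split: if_splits)
      \<comment> \<open>A positive letter cannot lie in the descent, and \<open>- x\<close> in
        \<open>w\<close> would belong to \<open>A\<close> or \<open>B\<close>.\<close>
      with neg \<open>x \<in> {1..int n}\<close> desc show ?thesis
        by (auto simp: w_eq A_def B_def)
    qed (simp add: B_def)
  qed
  \<comment> \<open>Strictly ascending lists with equal sets of entries coincide, which identifies
    both halves of \<open>w\<close>.\<close>
  moreover have "sorted_wrt (<) (rev D)" "sorted_wrt (<) I"
    using desc asc by (auto simp: sorted_wrt_rev)
  ultimately have revD: "rev D = sorted_list_of_set A"
    and I: "I = sorted_list_of_set (ascent_letters n A B)"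
    using sorted_valley_word(3,4)[OF in_Q]
    by (auto intro!: strict_sorted_equal simp: A_def)
  from revD have "D = rev (sorted_list_of_set A)" by (metis rev_rev_ident)
  with I have "w = valley_word n (A, B)"
    by (simp add: valley_word_def w_eq)
  with in_Q show "w \<in> valley_word n ` dominated_pairs {- int n..-1}" by blast
qed

theorem theorem3p3:
  fixes n :: nat
  assumes "n \<ge> 1"
  shows "real (card (P_hat_B {} n)) = (3 ^ n + 1) / 2"
proof -
  have "bij_betw (valley_word n) (dominated_pairs {- int n..-1}) (P_hat_B {} n)"
    unfolding bij_betw_def
    using inj_on_valley_word P_hat_B_subset_valley_word valley_word_in_P_hat_B
    by auto
  then have "2 * card (P_hat_B {} n) = 3 ^ n + 1"
    using card_dominated_pairs[of "{- int n..-1}"] by (simp add: bij_betw_same_card)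
  then have "2 * real (card (P_hat_B {} n)) = 3 ^ n + 1"
    by (metis of_nat_1 of_nat_add of_nat_mult of_nat_numeral of_nat_power)
  then show ?thesis by simp
qed

end
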